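(* Let $\delta\in\mathbb{C}$, let $(\mathcal{A},\cdot)$ be a commutative associative algebra over $\mathbb{C}$, and let $\varphi$ be a nontrivial (nonzero) $\delta$-derivation of $\mathcal{A}$. Define $$[\![ a,b]\!]=a\varphi(b)-\varphi(a)b,\qquad a,b\in\mathcal{A}.$$ Then $(\mathcal{A},\cdot,[\![\cdot,\cdot]\!])$ is a transposed $(\delta+1)$-Poisson algebra.
   Context: A $\delta$-derivation of an algebra $\mathcal{A}$ is a linear map $\varphi:\mathcal{A}\to\mathcal{A}$ with $\varphi(xy)=\delta(\varphi(x)y+x\varphi(y))$ for all $x,y$. For $\gamma\in\mathbb{C}$, a transposed $\gamma$-Poisson algebra is a triple $(P,\cdot,\{\cdot,\cdot\})$ such that $(P,\cdot)$ is a commutative associative algebra, $(P,\{\cdot,\cdot\})$ is a Lie algebra, and $\gamma\, x\{y,z\}=\{xy,z\}+\{y,xz\}$ for all $x,y,z\in P$. *)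

theory Defs
  imports Complex_Main
begin

text \<open>
  The underlying vector space of an algebra is the whole of a type; its scalar multiplication and its
  product are explicit parameters. The product need be neither associative nor unital, so that
  the same locale serves for associative products and Lie brackets.
\<close>

locale complex_algebra = vector_space scale
  for scale :: "complex \<Rightarrow> 'a::ab_group_add \<Rightarrow> 'a" +
  fixes mult :: "'a \<Rightarrow> 'a \<Rightarrow> 'a"
  assumes linear_mult_left: "Vector_Spaces.linear scale scale (\<lambda>x. mult x y)"
    and linear_mult_right: "Vector_Spaces.linear scale scale (\<lambda>y. mult x y)"

locale comm_assoc_algebra =
  complex_algebra scale mult + mult: abel_semigroup mult
  for scale :: "complex \<Rightarrow> 'a::ab_group_add \<Rightarrow> 'a" and mult :: "'a \<Rightarrow> 'a \<Rightarrow> 'a"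

locale lie_algebra =
  complex_algebra scale bracket
  for scale :: "complex \<Rightarrow> 'a::ab_group_add \<Rightarrow> 'a" and bracket :: "'a \<Rightarrow> 'a \<Rightarrow> 'a" +
  assumes alternating: "bracket x x = 0"
    and jacobi: "bracket x (bracket y z) + bracket y (bracket z x) + bracket z (bracket x y) = 0"

locale transposed_poisson_algebra =
  comm_assoc_algebra scale mult + lie: lie_algebra scale bracket
  for \<gamma> :: complex
    and scale :: "complex \<Rightarrow> 'a::ab_group_add \<Rightarrow> 'a"
    and mult :: "'a \<Rightarrow> 'a \<Rightarrow> 'a"
    and bracket :: "'a \<Rightarrow> 'a \<Rightarrow> 'a" +
  assumes transposed_leibniz:
    "scale \<gamma> (mult x (bracket y z)) = bracket (mult x y) z + bracket y (mult x z)"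

definition delta_derivation ::
  "complex \<Rightarrow> (complex \<Rightarrow> 'a::ab_group_add \<Rightarrow> 'a) \<Rightarrow> ('a \<Rightarrow> 'a \<Rightarrow> 'a) \<Rightarrow> ('a \<Rightarrow> 'a) \<Rightarrow> bool" where
  "delta_derivation \<delta> scale mult \<phi> \<longleftrightarrow>
     Vector_Spaces.linear scale scale \<phi> \<and>
     (\<forall>x y. \<phi> (mult x y) = scale \<delta> (mult (\<phi> x) y + mult x (\<phi> y)))"

end

theory Submission
  imports Defs
begin

text \<open>
  Write \<open>[a, b]\<close> (below \<open>bracket a b\<close>) for \<open>a \<cdot> \<phi> b - \<phi> a \<cdot> b\<close>. The compatibility
  condition and the Jacobi identity both come from expanding \<open>\<phi>\<close> of a product and cancelling by commutativity.

  For compatibility, \<open>[x \<cdot> y, z] + [y, x \<cdot> z]\<close> contains \<open>x \<cdot> [y, z]\<close> together with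
  \<open>y \<cdot> \<phi> (x \<cdot> z) - \<phi> (x \<cdot> y) \<cdot> z\<close>. In the latter the two terms with \<open>\<phi> x\<close> cancel, which leaves
  \<open>\<delta> x \<cdot> [y, z]\<close>; hence the factor \<open>\<delta> + 1\<close>.

  For Jacobi, the key is \<open>\<phi> [y, z] = \<delta> (y \<cdot> \<phi>\<^sup>2 z - \<phi>\<^sup>2 y \<cdot> z)\<close> (\<open>phi_bracket\<close>): the two copies of
  \<open>\<phi> y \<cdot> \<phi> z\<close> cancel. Thus \<open>[x, [y, z]]\<close> is the sum of \<open>\<delta> (x \<cdot> y \<cdot> \<phi>\<^sup>2 z - x \<cdot> \<phi>\<^sup>2 y \<cdot> z)\<close> and
  \<open>\<phi> x \<cdot> \<phi> y \<cdot> z - \<phi> x \<cdot> y \<cdot> \<phi> z\<close>. Each of these is a difference of two terms,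
  one of which a cyclic permutation of \<open>x, y, z\<close> carries into the other (up to commutativity), so
  each cyclic sum vanishes.
\<close>

locale delta_derivation_algebra = comm_assoc_algebra scale mult
  for scale :: "complex \<Rightarrow> 'a::ab_group_add \<Rightarrow> 'a" and mult :: "'a \<Rightarrow> 'a \<Rightarrow> 'a" (infixl \<open>\<bullet>\<close> 70) +
  fixes \<delta> :: complex and \<phi> :: "'a \<Rightarrow> 'a"
  assumes delta_derivation: "delta_derivation \<delta> scale mult \<phi>"
begin

definition bracket :: "'a \<Rightarrow> 'a \<Rightarrow> 'a" where
  "bracket a b = a \<bullet> \<phi> b - \<phi> a \<bullet> b"

lemma linear_phi: "Vector_Spaces.linear scale scale \<phi>"
  and phi_mult: "\<phi> (x \<bullet> y) = scale \<delta> (\<phi> x \<bullet> y + x \<bullet> \<phi> y)"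
  using delta_derivation unfolding delta_derivation_def by blast+

sublocale phi: Vector_Spaces.linear scale scale \<phi>
  by (rule linear_phi)

sublocale mult_left: Vector_Spaces.linear scale scale "\<lambda>x. x \<bullet> y" for y
  by (rule linear_mult_left)

sublocale mult_right: Vector_Spaces.linear scale scale "\<lambda>y. x \<bullet> y" for x
  by (rule linear_mult_right)

lemmas expand =
  phi.add phi.diff phi.scale mult_left.add mult_left.diff mult_left.scale
  mult_right.add mult_right.diff mult_right.scale scale_right_distrib scale_right_diff_distrib

lemmas mult_ac = mult.assoc mult.commute mult.left_commute

lemma phi_bracket: "\<phi> (bracket y z) = scale \<delta> (y \<bullet> \<phi> (\<phi> z) - \<phi> (\<phi> y) \<bullet> z)"
  by (simp add: bracket_def phi_mult expand)

lemma bracket_bilinear: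
  "bracket (a + b) c = bracket a c + bracket b c"
  "bracket (scale r a) c = scale r (bracket a c)"
  "bracket a (b + c) = bracket a b + bracket a c"
  "bracket a (scale r c) = scale r (bracket a c)"
  by (simp_all add: bracket_def expand)

text \<open>
  The terms are grouped by degree in \<open>\<delta>\<close>, so that each group cancels by itself in the cyclic sum.
\<close>

lemma bracket_bracket:
  "bracket x (bracket y z) =
     scale \<delta> (x \<bullet> y \<bullet> \<phi> (\<phi> z) - x \<bullet> \<phi> (\<phi> y) \<bullet> z) + (\<phi> x \<bullet> \<phi> y \<bullet> z - \<phi> x \<bullet> y \<bullet> \<phi> z)"
proof -
  have "bracket x (bracket y z) = x \<bullet> \<phi> (bracket y z) - \<phi> x \<bullet> bracket y z"
    by (simp add: bracket_def)
  then show ?thesis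
    unfolding phi_bracket by (simp add: bracket_def expand mult.assoc)
qed

lemma jacobi:
  "bracket x (bracket y z) + bracket y (bracket z x) + bracket z (bracket x y) = 0"
  unfolding bracket_bracket by (simp add: expand mult_ac)

lemma transposed_leibniz:
  "scale (\<delta> + 1) (x \<bullet> bracket y z) = bracket (x \<bullet> y) z + bracket y (x \<bullet> z)"
  by (simp add: bracket_def phi_mult expand scale_left_distrib mult_ac)

lemma transposed_poisson: "transposed_poisson_algebra (\<delta> + 1) scale mult bracket"
proof unfold_locales
  show "bracket x x = 0" for x
    by (simp add: bracket_def mult.commute)
qed (fact bracket_bilinear jacobi transposed_leibniz)+

end

theorem corollary42:
  fixes \<delta> :: complex
    and scale :: "complex \<Rightarrow> 'a::ab_group_add \<Rightarrow> 'a"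
    and mult :: "'a \<Rightarrow> 'a \<Rightarrow> 'a"
    and \<phi> :: "'a \<Rightarrow> 'a"
  assumes "comm_assoc_algebra scale mult"
    and "delta_derivation \<delta> scale mult \<phi>"
    and "\<phi> \<noteq> (\<lambda>_. 0)"
  shows "transposed_poisson_algebra (\<delta> + 1) scale mult (\<lambda>a b. mult a (\<phi> b) - mult (\<phi> a) b)"
proof -
  interpret comm_assoc_algebra scale mult
    by (rule assms(1))
  interpret delta_derivation_algebra scale mult \<delta> \<phi>
    by unfold_locales (rule assms(2))
  show ?thesis
    using transposed_poisson unfolding bracket_def[abs_def] .
qed

end
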